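(* Let $\mathbb{K}$ be an algebraically closed field of characteristic zero, let $\Gamma$ be a finite, simple, connected, undirected graph without loops with vertex set $V=\{1,\dots,n\}$, $n\ge 2$, and let $\mathcal{A}\in\{\mathcal{A}_\Gamma,\mathcal{A}_{RW(\Gamma)}\}$ be one of the two evolution $\mathbb{K}$-algebras associated to $\Gamma$. Let $\mathcal{D}\le \operatorname{Aut}(\mathcal{A})$ be the diagonal subgroup. Then either $\mathcal{D}=\{\mathrm{Id}\}$ or $\mathcal{D}\cong\mathbb{Z}_3$ (the cyclic group of order $3$).
   Context: For $i\in V$, $\mathcal{N}(i)=\{j\in V : \{i,j\}\text{ is an edge of }\Gamma\}$ and $d_i=|\mathcal{N}(i)|$. $\mathcal{A}_\Gamma$ is the $\mathbb{K}$-algebra with basis $B=\{e_1,\dots,e_n\}$ and bilinear product determined by $e_ie_j=0$ for $i\ne j$ and $e_i^2=\sum_{k\in\mathcal{N}(i)}e_k$. $\mathcal{A}_{RW(\Gamma)}$ is the $\mathbb{K}$-algebra with basis $B=\{e_1,\dots,e_n\}$ and bilinear product determined by $e_ie_j=0$ for $i\neq j$ and $e_i^2=\frac{1}{d_i}\sum_{k\in\mathcal{N}(i)}e_k$. $\operatorname{Aut}(\mathcal{A})$ is the group of bijective $\mathbb{K}$-linear maps $f:\mathcal{A}\to\mathcal{A}$ with $f(xy)=f(x)f(y)$ for all $x,y$. The diagonal subgroup $\mathcal{D}\le\operatorname{Aut}(\mathcal{A})$ is the set of $f\in\operatorname{Aut}(\mathcal{A})$ such that for every $i\in V$, $f(e_i)=t_{ii}e_i$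 for some $t_{ii}\in\mathbb{K}^*$. *)

theory Defs
  imports
    "HOL-Analysis.Cartesian_Space"
    "HOL-Computational_Algebra.Polynomial"
    "HOL-Algebra.Elementary_Groups"
    "Graph_Theory.Digraph_Component"
begin

text \<open>
  A finite simple undirected graph is a \<open>pair_graph\<close>, that is, a finite loop-free symmetric
  relation \<open>parcs G\<close> on \<open>pverts G\<close>: the edge $\{i,j\}$ is represented by the two pairs
  \<open>(i, j)\<close> and \<open>(j, i)\<close>.
  The vertex set $\{1,\dots,n\}$ is played by a finite type \<open>'n\<close>, and the algebra with basis
  $e_1,\dots,e_n$ by the coordinate space \<open>'k ^ 'n\<close> with $e_i$ = \<open>axis i 1\<close>. The pointwise
  multiplication that the library puts on \<open>'k ^ 'n\<close> is never used.
\<close>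

definition neighbours :: "'n pair_pre_digraph \<Rightarrow> 'n \<Rightarrow> 'n set" where
  "neighbours G i = {j \<in> pverts G. (i, j) \<in> parcs G}"

definition vdegree :: "'n pair_pre_digraph \<Rightarrow> 'n \<Rightarrow> nat" where
  "vdegree G i = card (neighbours G i)"

text \<open>
  The bilinear product with $e_i e_j = 0$ for $i \ne j$ and $e_i^2$ = \<open>s i\<close>;
  see \<open>evolution_mult_unique\<close> below.
\<close>
definition evolution_mult ::
    "('n::finite \<Rightarrow> 'k::field ^ 'n) \<Rightarrow> 'k ^ 'n \<Rightarrow> 'k ^ 'n \<Rightarrow> 'k ^ 'n" where
  "evolution_mult s x y = (\<Sum>i\<in>UNIV. (x $ i * y $ i) *s s i)"

definition graph_mult ::
    "'n::finite pair_pre_digraph \<Rightarrow> 'k::field ^ 'n \<Rightarrow> 'k ^ 'n \<Rightarrow> 'k ^ 'n" where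
  "graph_mult G = evolution_mult (\<lambda>i. \<Sum>k\<in>neighbours G i. axis k 1)"

definition random_walk_mult ::
    "'n::finite pair_pre_digraph \<Rightarrow> 'k::field ^ 'n \<Rightarrow> 'k ^ 'n \<Rightarrow> 'k ^ 'n" where
  "random_walk_mult G =
     evolution_mult (\<lambda>i. (1 / of_nat (vdegree G i)) *s (\<Sum>k\<in>neighbours G i. axis k 1))"

definition algebra_Aut ::
    "('k::field ^ 'n::finite \<Rightarrow> 'k ^ 'n \<Rightarrow> 'k ^ 'n) \<Rightarrow> ('k ^ 'n \<Rightarrow> 'k ^ 'n) monoid" where
  "algebra_Aut m =
     \<lparr>carrier = {f. Vector_Spaces.linear (*s) (*s) f \<and> bij f \<and> (\<forall>x y. f (m x y) = m (f x) (f y))},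
      mult = (\<circ>), one = id\<rparr>"

definition diagonal_Aut ::
    "('k::field ^ 'n::finite \<Rightarrow> 'k ^ 'n \<Rightarrow> 'k ^ 'n) \<Rightarrow> ('k ^ 'n \<Rightarrow> 'k ^ 'n) set" where
  "diagonal_Aut m =
     {f \<in> carrier (algebra_Aut m). \<forall>i. \<exists>t. t \<noteq> 0 \<and> f (axis i 1) = t *s axis i 1}"

lemma vec_linearI:
  fixes f :: "'k::field ^ 'n::finite \<Rightarrow> 'k ^ 'n"
  assumes "\<And>x y. f (x + y) = f x + f y" "\<And>c x. f (c *s x) = c *s f x"
  shows "Vector_Spaces.linear (*s) (*s) f"
  unfolding Vector_Spaces.linear_iff using assms vec.vector_space_axioms by blast

lemma linear_axis_expand:
  fixes f :: "'k::field ^ 'n::finite \<Rightarrow> 'k ^ 'n"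
  assumes "Vector_Spaces.linear (*s) (*s) f"
  shows "f x = (\<Sum>i\<in>UNIV. x $ i *s f (axis i 1))"
proof -
  interpret f: Vector_Spaces.linear "(*s)" "(*s)" f by fact
  have "f x = f (\<Sum>i\<in>UNIV. x $ i *s axis i 1)" by (simp add: basis_expansion)
  then show ?thesis by (simp add: f.sum f.scale)
qed

lemma evolution_mult_axis:
  "evolution_mult s (axis i 1) (axis j 1) = (if i = j then s i else 0)"
proof -
  have "evolution_mult s (axis i 1) (axis j 1) =
      (\<Sum>k\<in>UNIV. if k = i then (if i = j then s i else 0) else 0)"
    unfolding evolution_mult_def by (rule sum.cong) (auto simp: axis_def)
  then show ?thesis by simp
qed

lemma evolution_mult_linear:
  "Vector_Spaces.linear (*s) (*s) (evolution_mult s x)"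
  "Vector_Spaces.linear (*s) (*s) (\<lambda>x. evolution_mult s x y)"
  by (rule vec_linearI;
      simp add: evolution_mult_def sum.distrib distrib_left distrib_right
        vec.scale_left_distrib vec.scale_sum_right mult.assoc mult.left_commute)+

lemma evolution_mult_unique:
  assumes "\<And>x. Vector_Spaces.linear (*s) (*s) (m x)"
    and "\<And>y. Vector_Spaces.linear (*s) (*s) (\<lambda>x. m x y)"
    and "\<And>i j. m (axis i 1) (axis j 1) = (if i = j then s i else 0)"
  shows "m = evolution_mult s"
proof (intro ext)
  fix x y
  have "m x y = (\<Sum>i\<in>UNIV. x $ i *s m (axis i 1) y)"
    by (rule linear_axis_expand[OF assms(2)])
  also have "\<dots> = (\<Sum>i\<in>UNIV. x $ i *s (\<Sum>j\<in>UNIV. y $ j *s m (axis i 1) (axis j 1)))"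
    by (rule sum.cong[OF refl], rule arg_cong[of _ _ "(*s) _"], rule linear_axis_expand[OF assms(1)])
  also have "\<dots> = evolution_mult s x y"
  proof -
    have "(\<Sum>j\<in>UNIV. y $ j *s m (axis i 1) (axis j 1)) = y $ i *s s i" for i
    proof -
      have "(\<Sum>j\<in>UNIV. y $ j *s m (axis i 1) (axis j 1)) =
          (\<Sum>j\<in>UNIV. if j = i then y $ i *s s i else 0)"
        by (rule sum.cong) (auto simp: assms(3))
      then show ?thesis by simp
    qed
    then show ?thesis by (simp add: evolution_mult_def)
  qed
  finally show "m x y = evolution_mult s x y" .
qed

lemma linear_bij_inv:
  fixes f :: "'k::field ^ 'n::finite \<Rightarrow> 'k ^ 'n"
  assumes "Vector_Spaces.linear (*s) (*s) f" "bij f"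
  shows "Vector_Spaces.linear (*s) (*s) (inv_into UNIV f)"
proof -
  interpret f: Vector_Spaces.linear "(*s)" "(*s)" f by fact
  show ?thesis
    by (rule vec_linearI; rule inv_f_eq)
       (simp_all add: assms bij_is_inj f.add f.scale bij_is_surj surj_f_inv_f)
qed

lemma inv_in_Aut:
  assumes "f \<in> carrier (algebra_Aut m)"
  shows "inv_into UNIV f \<in> carrier (algebra_Aut m)"
proof -
  have f: "Vector_Spaces.linear (*s) (*s) f" "bij f" "\<And>x y. f (m x y) = m (f x) (f y)"
    using assms by (auto simp: algebra_Aut_def)
  have "inv_into UNIV f (m x y) = m (inv_into UNIV f x) (inv_into UNIV f y)" for x y
    using f by (intro inv_f_eq) (simp_all add: bij_is_inj bij_is_surj surj_f_inv_f)
  then show ?thesis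
    using f by (simp add: algebra_Aut_def linear_bij_inv bij_imp_bij_inv)
qed

lemma group_algebra_Aut: "group (algebra_Aut m)"
proof (rule groupI)
  fix f assume f: "f \<in> carrier (algebra_Aut m)"
  then have "inv_into UNIV f \<otimes>\<^bsub>algebra_Aut m\<^esub> f = \<one>\<^bsub>algebra_Aut m\<^esub>"
    by (simp add: algebra_Aut_def bij_is_inj)
  then show "\<exists>g\<in>carrier (algebra_Aut m). g \<otimes>\<^bsub>algebra_Aut m\<^esub> f = \<one>\<^bsub>algebra_Aut m\<^esub>"
    using inv_in_Aut[OF f] by blast
qed (auto simp: algebra_Aut_def o_assoc vec.linear_id bij_comp Vector_Spaces.linear_compose)

lemma subgroup_diagonal_Aut: "subgroup (diagonal_Aut m) (algebra_Aut m)"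
proof -
  interpret group "algebra_Aut m" by (rule group_algebra_Aut)
  show ?thesis
  proof
    show "diagonal_Aut m \<subseteq> carrier (algebra_Aut m)" by (auto simp: diagonal_Aut_def)
    have "\<exists>t. t \<noteq> 0 \<and> axis i 1 = t *s axis i (1::'a)" for i :: 'b
      by (rule exI[of _ 1]) simp
    then show "\<one>\<^bsub>algebra_Aut m\<^esub> \<in> diagonal_Aut m"
      using one_closed by (simp add: diagonal_Aut_def algebra_Aut_def)
  next
    fix f g assume fg: "f \<in> diagonal_Aut m" "g \<in> diagonal_Aut m"
    then have c: "f \<in> carrier (algebra_Aut m)" "g \<in> carrier (algebra_Aut m)"
      by (auto simp: diagonal_Aut_def)
    interpret f: Vector_Spaces.linear "(*s)" "(*s)" f
      using c by (simp add: algebra_Aut_def)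
    have "\<exists>t. t \<noteq> 0 \<and> f (g (axis i 1)) = t *s axis i 1" for i
    proof -
      obtain s t where "s \<noteq> 0" "t \<noteq> 0" "f (axis i 1) = s *s axis i 1" "g (axis i 1) = t *s axis i 1"
        using fg unfolding diagonal_Aut_def by blast
      then show ?thesis by (intro exI[of _ "t * s"]) (simp add: f.scale)
    qed
    moreover have "f \<otimes>\<^bsub>algebra_Aut m\<^esub> g = f \<circ> g" by (simp add: algebra_Aut_def)
    ultimately show "f \<otimes>\<^bsub>algebra_Aut m\<^esub> g \<in> diagonal_Aut m"
      using m_closed[OF c] by (simp add: diagonal_Aut_def)
  next
    fix f assume fd: "f \<in> diagonal_Aut m"
    then have c: "f \<in> carrier (algebra_Aut m)" by (auto simp: diagonal_Aut_def)
    then have b: "bij f" by (simp add: algebra_Aut_def)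
    interpret f: Vector_Spaces.linear "(*s)" "(*s)" f
      using c by (simp add: algebra_Aut_def)
    have i: "inv\<^bsub>algebra_Aut m\<^esub> f = inv_into UNIV f"
      by (rule inv_equality) (use c inv_in_Aut[OF c] b in \<open>auto simp: algebra_Aut_def bij_is_inj\<close>)
    have "\<exists>t. t \<noteq> 0 \<and> inv_into UNIV f (axis i 1) = t *s axis i 1" for i
    proof -
      obtain t where t: "t \<noteq> 0" "f (axis i 1) = t *s axis i 1"
        using fd unfolding diagonal_Aut_def by blast
      then have "f (inverse t *s axis i 1) = axis i 1" by (simp add: f.scale)
      then have "inv_into UNIV f (axis i 1) = inverse t *s axis i 1"
        using b by (intro inv_f_eq) (simp_all add: bij_is_inj)
      then show ?thesis using t by (intro exI[of _ "inverse t"]) simp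
    qed
    then show "inv\<^bsub>algebra_Aut m\<^esub> f \<in> diagonal_Aut m"
      using inv_in_Aut[OF c] by (simp add: diagonal_Aut_def i)
  qed
qed

end

theory Submission
  imports
    Defs
    "HOL-Algebra.Multiplicative_Group"
begin

text \<open>
  If a diagonal automorphism acts by \<open>t\<^sub>i\<close> on \<open>e\<^sub>i\<close>, then applying it to \<open>e\<^sub>i\<^sup>2\<close> gives
  \<open>t\<^sub>k = t\<^sub>i\<^sup>2\<close> for every edge \<open>{i, k}\<close>. By symmetry \<open>t\<^sub>i = t\<^sub>i\<^sup>4\<close>, so \<open>t\<^sub>i\<close> is a cube root of unity,
  and by connectedness one \<open>t\<^sub>i\<close> determines all the others. Thus the diagonal subgroup
  embeds into the group of cube roots of unity.
\<close>

text \<open>The exponent map \<open>k \<mapsto> a [^] k\<close> depends only on \<open>k\<close>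
  modulo \<open>ord a\<close>, so it is injective on residues. Infinite order is covered by
  \<open>ord a = 0\<close>, where \<open>k mod 0 = k\<close>.\<close>

lemma (in group) cyclic_iso_integer_mod_group:
  assumes a: "a \<in> carrier G" and gen: "carrier G \<subseteq> range (\<lambda>k::int. a [^] k)"
  shows "G \<cong> integer_mod_group (ord a)"
proof -
  have mod_eq: "a [^] (k mod int (ord a)) = a [^] k" for k :: int
    using a by (simp add: int_pow_eq mod_eq_dvd_iff[symmetric])
  have mod_carrier: "k mod int (ord a) \<in> carrier (integer_mod_group (ord a))" for k :: int
    by (simp add: carrier_integer_mod_group)
  let ?h = "\<lambda>k::int. a [^] k"
  have "?h \<in> iso (integer_mod_group (ord a)) G"
    unfolding iso_def hom_def bij_betw_def
  proof (intro CollectI conjI ballI Pi_I)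
    show "inj_on ?h (carrier (integer_mod_group (ord a)))"
    proof (rule inj_onI)
      fix k l assume kl: "k \<in> carrier (integer_mod_group (ord a))"
        "l \<in> carrier (integer_mod_group (ord a))" "a [^] k = a [^] l"
      then have "k mod int (ord a) = l mod int (ord a)"
        using a by (simp add: int_pow_eq mod_eq_dvd_iff dvd_diff_commute)
      then show "k = l" using kl by (auto simp: carrier_integer_mod_group split: if_splits)
    qed
    show "?h ` carrier (integer_mod_group (ord a)) = carrier G"
    proof
      show "carrier G \<subseteq> ?h ` carrier (integer_mod_group (ord a))"
      proof
        fix g assume "g \<in> carrier G"
        then obtain k :: int where "g = a [^] k" using gen by blast
        then have "g = ?h (k mod int (ord a))" by (simp add: mod_eq)
        then show "g \<in> ?h ` carrier (integer_mod_group (ord a))" using mod_carrier by blast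
      qed
    qed (use a in auto)
  qed (use a in \<open>auto simp: mod_eq int_pow_mult\<close>)
  then show ?thesis
    by (meson group.iso_sym group_integer_mod_group is_isoI)
qed

lemma cube_roots_of_unity:
  fixes x y :: "'k::field"
  assumes "x ^ 3 = 1" "y ^ 3 = 1" "x \<noteq> 1"
  shows "y \<in> {1, x, x * x}"
proof -
  have "(x - 1) * (1 + x + x * x) = 0"
    using assms(1) by (simp add: algebra_simps power3_eq_cube)
  then have x: "1 + x + x * x = 0" using assms(3) by simp
  \<comment> \<open>A polynomial identity valid for arbitrary \<open>x\<close> and \<open>y\<close>;
    its right-hand side vanishes by the hypotheses and \<open>x\<close>, leaving a product of three
    factors equal to 0.\<close>
  have "(y - 1) * (y - x) * (y - x * x) = y ^ 3 - x ^ 3 - y * (y - x) * (1 + x + x * x)"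
    by (simp add: algebra_simps power3_eq_cube)
  then show ?thesis using assms x by auto
qed

text \<open>Since \<open>h\<close> embeds the group into the cube roots of unity, any
  \<open>a\<close> other than the identity has a nontrivial root as image. The powers of that root
  are all the cube roots, so \<open>a\<close> generates.\<close>

lemma (in group) trivial_or_iso_Z3:
  fixes h :: "'a \<Rightarrow> 'k::field"
  assumes inj: "inj_on h (carrier G)"
    and mult: "\<And>f g. f \<in> carrier G \<Longrightarrow> g \<in> carrier G \<Longrightarrow> h (f \<otimes> g) = h f * h g"
    and cube: "\<And>f. f \<in> carrier G \<Longrightarrow> h f ^ 3 = 1"
  shows "carrier G = {\<one>} \<or> G \<cong> integer_mod_group 3"
proof (cases "carrier G = {\<one>}")
  case False
  then obtain a where a: "a \<in> carrier G" "a \<noteq> \<one>" using one_closed by blast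
  \<comment> \<open>\<open>h \<one>\<close> is idempotent, hence 0 or 1, and its cube being 1
    excludes 0.\<close>
  have one: "h \<one> = 1"
    using mult[of \<one> \<one>] cube[of \<one>] by auto
  have eqI: "f = g" if "h f = h g" "f \<in> carrier G" "g \<in> carrier G" for f g
    using inj that by (rule inj_onD)
  have "h a \<noteq> 1" using a one eqI[of a \<one>] by auto
  note roots = cube_roots_of_unity[OF cube[OF a(1)] cube this]
  have "a [^] (3::nat) = \<one>"
    using a cube[OF a(1)] one by (intro eqI) (simp_all add: numeral_3_eq_3 mult mult.assoc)
  then have "ord a dvd 3" using a by (simp add: pow_eq_id)
  moreover have "ord a \<noteq> 1" using a ord_eq_1 by metis
  moreover have "prime (3::nat)" by simp
  ultimately have ord: "ord a = 3" by (metis prime_nat_iff)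
  have "carrier G \<subseteq> range (\<lambda>k::int. a [^] k)"
  proof
    fix g assume g: "g \<in> carrier G"
    have "g \<in> {\<one>, a, a \<otimes> a}"
      using roots[OF g] a g one by (auto intro: eqI simp: mult)
    moreover have "\<one> = a [^] (0::int)" "a = a [^] (1::int)" "a \<otimes> a = a [^] (2::int)"
      using a int_pow_mult[of a 1 1] by simp_all
    ultimately show "g \<in> range (\<lambda>k::int. a [^] k)" by blast
  qed
  from cyclic_iso_integer_mod_group[OF a(1) this] show ?thesis by (simp add: ord)
qed simp

text \<open>Turns the existential eigenvalue into an explicit term, which can serve as a function of
  \<open>f\<close> and \<open>i\<close>.\<close>

lemma diagonal_Aut_axis:
  assumes "f \<in> diagonal_Aut m"
  shows "f (axis i 1) = (f (axis i 1) $ i) *s axis i 1"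
proof -
  obtain t where "f (axis i 1) = t *s axis i 1" using assms unfolding diagonal_Aut_def by blast
  then show ?thesis by simp
qed

lemma diagonal_Aut_nth:
  assumes "f \<in> diagonal_Aut m"
  shows "f x $ k = x $ k * f (axis k 1) $ k"
proof -
  have "Vector_Spaces.linear (*s) (*s) f"
    using assms by (simp add: diagonal_Aut_def algebra_Aut_def)
  then have "f x $ k = (\<Sum>i\<in>UNIV. x $ i *s f (axis i 1)) $ k"
    by (subst linear_axis_expand) auto
  also have "\<dots> = (\<Sum>i\<in>UNIV. if i = k then x $ k * f (axis k 1) $ k else 0)"
    unfolding sum_component
  proof (rule sum.cong[OF refl])
    fix i
    have "f (axis i 1) $ k = (if i = k then f (axis k 1) $ k else 0)"
      by (subst diagonal_Aut_axis[OF assms]) (simp add: axis_def)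
    then show "(x $ i *s f (axis i 1)) $ k = (if i = k then x $ k * f (axis k 1) $ k else 0)"
      by simp
  qed
  finally show ?thesis by simp
qed

text \<open>The \<open>k\<close>-th coordinate of \<open>f (s i)\<close> is \<open>s i $ k\<close>
  times the eigenvalue at \<open>k\<close>, but also times the squared eigenvalue at
  \<open>i\<close>. The nonzero factor \<open>s i $ k\<close> cancels, whatever its value.\<close>

lemma diagonal_Aut_evolution_square:
  assumes f: "f \<in> diagonal_Aut (evolution_mult s)" and k: "s i $ k \<noteq> 0"
  shows "f (axis k 1) $ k = (f (axis i 1) $ i)\<^sup>2"
proof -
  let ?t = "f (axis i 1) $ i"
  have "f (s i) = evolution_mult s (f (axis i 1)) (f (axis i 1))"
  proof -
    have "f (evolution_mult s (axis i 1) (axis i 1)) =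
        evolution_mult s (f (axis i 1)) (f (axis i 1))"
      using f unfolding diagonal_Aut_def algebra_Aut_def by simp
    then show ?thesis by (simp add: evolution_mult_axis)
  qed
  also have "\<dots> = evolution_mult s (?t *s axis i 1) (?t *s axis i 1)"
    by (rule arg_cong2[where f = "evolution_mult s"]) (rule diagonal_Aut_axis[OF f])+
  also have "\<dots> = ?t\<^sup>2 *s evolution_mult s (axis i 1) (axis i 1)"
    by (simp add: evolution_mult_def vec.scale_sum_right power2_eq_square mult_ac)
  also have "\<dots> = ?t\<^sup>2 *s s i" by (simp add: evolution_mult_axis)
  finally have "f (s i) $ k = ?t\<^sup>2 * s i $ k" by simp
  then show ?thesis using k unfolding diagonal_Aut_nth[OF f, of "s i"] by simp
qed

text \<open>Stated for any structure vectors \<open>s\<close> that are nonzero along the edges, so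
  that both graph algebras are instances.\<close>

lemma diagonal_Aut_evolution_trivial_or_Z3:
  fixes s :: "'n::finite \<Rightarrow> 'k::field ^ 'n"
  assumes "sym E" and conn: "\<And>u v. (u, v) \<in> E\<^sup>*" and card: "CARD('n) \<ge> 2"
    and s: "\<And>i k. (i, k) \<in> E \<Longrightarrow> s i $ k \<noteq> 0"
  defines "m \<equiv> evolution_mult s"
  shows "diagonal_Aut m = {id} \<or>
         (algebra_Aut m)\<lparr>carrier := diagonal_Aut m\<rparr> \<cong> integer_mod_group 3"
proof -
  define c :: "('k ^ 'n \<Rightarrow> 'k ^ 'n) \<Rightarrow> 'n \<Rightarrow> 'k" where "c f i = f (axis i 1) $ i" for f i
  have edge: "c f k = (c f i)\<^sup>2" if "f \<in> diagonal_Aut m" "(i, k) \<in> E" for f i k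
    unfolding c_def using that s by (intro diagonal_Aut_evolution_square) (auto simp: m_def)
  have nz: "c f i \<noteq> 0" if f: "f \<in> diagonal_Aut m" for f i
  proof -
    obtain t where "t \<noteq> 0" "f (axis i 1) = t *s axis i 1"
      using f unfolding diagonal_Aut_def by blast
    then show ?thesis by (simp add: c_def)
  qed
  \<comment> \<open>Fixes a base vertex; evaluating the eigenvalue there is the embedding into the
    cube roots of unity.\<close>
  obtain u :: 'n where "True" by simp
  have cube: "c f u ^ 3 = 1" if f: "f \<in> diagonal_Aut m" for f
  proof -
    \<comment> \<open>A second vertex \<open>v\<close> exists, and the first edge of a path from
      \<open>u\<close> to \<open>v\<close> provides a neighbour of \<open>u\<close>.\<close>
    have "\<not> CARD('n) \<le> Suc 0" using card by simp
    then obtain v where "v \<noteq> u" by (metis card_le_Suc0_iff_eq finite)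
    from conn[of u v] obtain k where "(u, k) \<in> E"
      using \<open>v \<noteq> u\<close> by (cases rule: converse_rtranclE) auto
    then have "(k, u) \<in> E" using \<open>sym E\<close> by (rule symD[rotated])
    then have "c f u = ((c f u)\<^sup>2)\<^sup>2"
      using edge[OF f \<open>(u, k) \<in> E\<close>] edge[OF f \<open>(k, u) \<in> E\<close>] by simp
    then have "c f u * (c f u ^ 3 - 1) = 0"
      by (simp add: algebra_simps power2_eq_square power3_eq_cube)
    then show ?thesis using nz[OF f] by simp
  qed
  have inj: "inj_on (\<lambda>f. c f u) (diagonal_Aut m)"
  proof (rule inj_onI)
    fix f g assume fg: "f \<in> diagonal_Aut m" "g \<in> diagonal_Aut m" and eq: "c f u = c g u"
    \<comment> \<open>Agreement at \<open>u\<close> spreads along paths, each edge squaring both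
      eigenvalues.\<close>
    have "c f v = c g v" for v
      using conn[of u v] by induction (use eq edge fg in auto)
    then have "f x $ v = g x $ v" for x v
      unfolding diagonal_Aut_nth[OF fg(1), of x] diagonal_Aut_nth[OF fg(2), of x]
      by (simp add: c_def)
    then show "f = g" by (simp add: fun_eq_iff vec_eq_iff)
  qed
  let ?D = "(algebra_Aut m)\<lparr>carrier := diagonal_Aut m\<rparr>"
  interpret D: group ?D
    using group.subgroup_imp_group[OF group_algebra_Aut subgroup_diagonal_Aut] .
  have "carrier ?D = {\<one>\<^bsub>?D\<^esub>} \<or> ?D \<cong> integer_mod_group 3"
  proof (rule D.trivial_or_iso_Z3[where h = "\<lambda>f. c f u"])
    fix f g assume fg: "f \<in> carrier ?D" "g \<in> carrier ?D"
    then have "f (g (axis u 1)) $ u = g (axis u 1) $ u * f (axis u 1) $ u"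
      by (intro diagonal_Aut_nth) simp
    then show "c (f \<otimes>\<^bsub>?D\<^esub> g) u = c f u * c g u"
      by (simp add: c_def algebra_Aut_def mult.commute)
  qed (use inj cube in simp_all)
  then show ?thesis by (simp add: algebra_Aut_def)
qed

text \<open>Connectedness means strong connectedness of the symmetric closure, which has the same
  reachability as the graph because the arcs are already symmetric.\<close>

lemma connected_imp_rtrancl_parcs:
  assumes "pair_graph G" "Digraph_Component.connected (with_proj G)"
    "u \<in> pverts G" "v \<in> pverts G"
  shows "(u, v) \<in> (parcs G)\<^sup>*"
proof -
  interpret pair_graph G by fact
  have "u \<rightarrow>\<^sup>*\<^bsub>mk_symmetric G\<^esub> v"
    using assms by (simp add: connected_def strongly_connected_def)
  then have "u \<rightarrow>\<^sup>*\<^bsub>with_proj G\<^esub> v" using reachable_mk_symmetric_eq[OF sym_arcs] by simp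
  then show ?thesis using reachable_rtranclI by auto
qed

theorem corollary2p10:
  fixes G :: "'n::finite pair_pre_digraph"
    and m :: "'k::{alg_closed_field, field_char_0} ^ 'n \<Rightarrow> 'k ^ 'n \<Rightarrow> 'k ^ 'n"
  assumes "pair_graph G"
    and "pverts G = UNIV"
    and "CARD('n) \<ge> 2"
    and "Digraph_Component.connected (with_proj G)"
    and "m \<in> {graph_mult G, random_walk_mult G}"
  shows "diagonal_Aut m = {id} \<or>
         (algebra_Aut m)\<lparr>carrier := diagonal_Aut m\<rparr> \<cong> integer_mod_group 3"
proof -
  interpret pair_graph G by fact
  have sym: "sym (parcs G)" using pair_sym_arcs by (simp add: symmetric_def)
  have conn: "(u, v) \<in> (parcs G)\<^sup>*" for u v
    using assms by (intro connected_imp_rtrancl_parcs) auto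
  have nth: "(\<Sum>j\<in>neighbours G i. axis j 1 :: 'k ^ 'n) $ k = 1" if "(i, k) \<in> parcs G" for i k
    using that assms(2) by (simp add: sum_component axis_def neighbours_def)
  \<comment> \<open>With this, the random walk coefficient \<open>1 / of_nat (vdegree G i)\<close>
    is nonzero in characteristic zero.\<close>
  have deg: "vdegree G i \<noteq> 0" if "(i, k) \<in> parcs G" for i k
    using that assms(2) by (auto simp: vdegree_def neighbours_def)
  from assms(5) consider "m = graph_mult G" | "m = random_walk_mult G" by blast
  then show ?thesis
  proof cases
    case 1
    then show ?thesis unfolding 1 graph_mult_def
      using nth by (intro diagonal_Aut_evolution_trivial_or_Z3[OF sym conn assms(3)]) simp
  next
    case 2
    then show ?thesis unfolding 2 random_walk_mult_def
      using nth deg by (intro diagonal_Aut_evolution_trivial_or_Z3[OF sym conn assms(3)]) simp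
  qed
qed

end
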